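(* For all integers $k \ge 2$ the following holds, where $k$ is fixed and $n\to\infty$: \[ \Omega_k\left(n^{\lfloor k/3\rfloor-5}\right) \le gsat_F(\mathbb{I}_{n,k}),\ gsat_S(\mathbb{I}_{n,k}) \le O_k\left(n^{k-\sqrt{k}/2}\right). \] That is, both $gsat_F(\mathbb{I}_{n,k})$ and $gsat_S(\mathbb{I}_{n,k})$ satisfy both the lower and the upper bound.
   Context: Let $[n]=\{1,2,\dots,n\}$ and let $\binom{[n]}{k}$ be the set of all $k$-element subsets of $[n]$. A family $\mathcal{F}$ of sets is intersecting if $F\cap G\neq\emptyset$ for all $F,G\in\mathcal{F}$. Let $\mathbb{I}_{n,k}$ be the collection of all intersecting families $\mathcal{F}\subseteq\binom{[n]}{k}$. The saturation game on $\mathbb{I}_{n,k}$: two players, Fast and Slow, alternately claim one previously unclaimed $k$-subset of $[n]$ per turn, such that at any time the family of all sets claimed so far (by both players together) is intersecting, i.e. belongs to $\mathbb{I}_{n,k}$. The game ends when there is no legal move, i.e. when the family of claimed sets is a maximal (with respect to inclusion) member of $\mathbb{I}_{n,k}$. The score of the game is the total number of sets claimed by the two players. Fast wants the score to be as low as possible, Slow wants it to be as high as possible. $gsat_F(\mathbb{I}_{n,k})$ (resp. $gsat_S(\mathbb{I}_{n,k})$) denotes the score when both players play optimally and Fast (resp. Slow) makes the first move. The subscript $k$ in $\Omega_k$, $O_k$ means that the implied positive constants may depend on $k$ (but not on $n$); the bounds are understood for all $n$ sufficiently large compared to $k$. *)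

theory Defs
  imports Complex_Main "HOL-Library.Landau_Symbols"
begin

definition ksubsets :: "nat \<Rightarrow> nat \<Rightarrow> nat set set" where
  "ksubsets n k = {A. A \<subseteq> {1..n} \<and> card A = k}"

definition intersecting :: "'a set set \<Rightarrow> bool" where
  "intersecting \<F> \<longleftrightarrow> (\<forall>A\<in>\<F>. \<forall>B\<in>\<F>. A \<inter> B \<noteq> {})"

definition intersecting_families :: "nat \<Rightarrow> nat \<Rightarrow> nat set set set" where
  "intersecting_families n k = {\<F>. \<F> \<subseteq> ksubsets n k \<and> intersecting \<F>}"

datatype player = Fast | Slow

definition legal_moves :: "nat \<Rightarrow> nat \<Rightarrow> nat set set \<Rightarrow> nat set set" where
  "legal_moves n k \<F> = {A \<in> ksubsets n k. A \<notin> \<F> \<and> insert A \<F> \<in> intersecting_families n k}"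

lemma finite_ksubsets: "finite (ksubsets n k)"
  unfolding ksubsets_def by (rule finite_subset[of _ "Pow {1..n}"]) auto

text \<open>The final score under optimal play, by backward induction, when \<open>\<F>\<close> is the family of all
  sets claimed so far and the given player is about to move.\<close>

function game_score :: "nat \<Rightarrow> nat \<Rightarrow> player \<Rightarrow> nat set set \<Rightarrow> nat" where
  "game_score n k p \<F> =
     (if legal_moves n k \<F> = {} then card \<F>
      else case p of
        Fast \<Rightarrow> Min ((\<lambda>A. game_score n k Slow (insert A \<F>)) ` legal_moves n k \<F>)
      | Slow \<Rightarrow> Max ((\<lambda>A. game_score n k Fast (insert A \<F>)) ` legal_moves n k \<F>))"
  by pat_completeness auto
termination
proof (relation "measure (\<lambda>(n, k, p, \<F>). card (ksubsets n k - \<F>))")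
  have dec: "card (ksubsets n k - insert A \<F>) < card (ksubsets n k - \<F>)"
    if "A \<in> legal_moves n k \<F>" for n k A \<F>
    using that by (intro psubset_card_mono) (auto simp: legal_moves_def finite_ksubsets)
  show "((n, k, Slow, insert A \<F>), (n, k, p, \<F>))
          \<in> measure (\<lambda>(n, k, p, \<F>). card (ksubsets n k - \<F>))"
    if "A \<in> legal_moves n k \<F>" for n k A \<F> p using dec[OF that] by simp
  show "((n, k, Fast, insert A \<F>), (n, k, p, \<F>))
          \<in> measure (\<lambda>(n, k, p, \<F>). card (ksubsets n k - \<F>))"
    if "A \<in> legal_moves n k \<F>" for n k A \<F> p using dec[OF that] by simp
qed simp

declare game_score.simps [simp del]

definition gsat_F :: "nat \<Rightarrow> nat \<Rightarrow> nat" where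
  "gsat_F n k = game_score n k Fast {}"

definition gsat_S :: "nat \<Rightarrow> nat \<Rightarrow> nat" where
  "gsat_S n k = game_score n k Slow {}"

end

theory Submission
  imports Defs
begin

text \<open>Upper bound: in each of her first about \<open>\<surd>k\<close> turns Fast meets every earlier set in a point that
  lies in at most one of her own sets, and fills up with points never used before. No point then lies
  in three of her sets, so the final family has covering number at least \<open>t \<ge> \<surd>k / 2\<close>, and an
  intersecting family with that covering number has at most \<open>k\<^sup>t n\<^bsup>k-t\<^esup>\<close> members.

  Lower bound: Slow maintains a kernel \<open>K\<close> meeting all claimed sets and plays \<open>K\<close> together with new
  points, so that her sets are pairwise disjoint outside \<open>K\<close>. A set of Fast that avoids \<open>K\<close> forces \<open>K\<close>
  to grow, but Slow can usually delay this by one turn: she first hits the new set \<open>G\<close> by one extra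
  point \<open>y\<close>, then answers the next set \<open>G'\<close> by adding to \<open>K\<close> a common point of \<open>G\<close> and \<open>G'\<close>. Choosing
  \<open>y\<close> in one fixed set \<open>C\<close> keeps her sets disjoint, unless all points of \<open>G \<inter> C\<close> were used before; in
  that case such a point is added to \<open>K\<close> at once, and every use of a point pays for one such step. So
  \<open>K\<close> gains at most two points for every three sets of Slow. After more than \<open>k\<close> of these no further
  set can avoid \<open>K\<close>, and all \<open>k\<close>-sets containing \<open>K\<close>, where \<open>|K|\<close> is about \<open>2k/3\<close>, end up being claimed.\<close>

subsection \<open>The game\<close>

lemma intersecting_family_finite:
  assumes "F \<in> intersecting_families n k"
  shows "finite F"
  using assms finite_subset[OF _ finite_ksubsets] by (auto simp: intersecting_families_def)

lemma intersecting_family_memberD: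
  assumes "F \<in> intersecting_families n k" "A \<in> F"
  shows "A \<subseteq> {1..n}" "card A = k" "finite A"
  using assms by (auto simp: intersecting_families_def ksubsets_def intro: finite_subset)

lemma intersecting_family_meet:
  assumes "F \<in> intersecting_families n k" "A \<in> F" "B \<in> F"
  shows "A \<inter> B \<noteq> {}"
  using assms by (auto simp: intersecting_families_def intersecting_def)

lemma finite_legal_moves: "finite (legal_moves n k F)"
  by (rule finite_subset[OF _ finite_ksubsets[of n k]]) (auto simp: legal_moves_def)

lemma legal_movesD:
  assumes "A \<in> legal_moves n k F"
  shows "insert A F \<in> intersecting_families n k" "A \<notin> F"
  using assms by (auto simp: legal_moves_def)

lemma empty_family: "{} \<in> intersecting_families n k"
  by (simp add: intersecting_families_def intersecting_def)

lemma game_score_terminal: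
  "legal_moves n k F = {} \<Longrightarrow> game_score n k p F = card F"
  by (simp add: game_score.simps)

lemma game_score_Fast:
  "legal_moves n k F \<noteq> {} \<Longrightarrow>
    game_score n k Fast F = Min ((\<lambda>A. game_score n k Slow (insert A F)) ` legal_moves n k F)"
  by (subst game_score.simps) simp

lemma game_score_Slow:
  "legal_moves n k F \<noteq> {} \<Longrightarrow>
    game_score n k Slow F = Max ((\<lambda>A. game_score n k Fast (insert A F)) ` legal_moves n k F)"
  by (subst game_score.simps) simp

lemma game_score_Fast_le:
  assumes "A \<in> legal_moves n k F" "game_score n k Slow (insert A F) \<le> b"
  shows "game_score n k Fast F \<le> b"
proof -
  have "game_score n k Fast F \<le> game_score n k Slow (insert A F)"
    using assms(1) by (subst game_score_Fast) (auto intro!: Min_le simp: finite_legal_moves)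
  with assms(2) show ?thesis by simp
qed

lemma game_score_Slow_ge:
  assumes "A \<in> legal_moves n k F" "b \<le> game_score n k Fast (insert A F)"
  shows "b \<le> game_score n k Slow F"
proof -
  have "game_score n k Fast (insert A F) \<le> game_score n k Slow F"
    using assms(1) by (subst game_score_Slow) (auto intro!: Max_ge simp: finite_legal_moves)
  with assms(2) show ?thesis by simp
qed

lemma game_score_Fast_ge:
  assumes "legal_moves n k F \<noteq> {}"
    and "\<And>A. A \<in> legal_moves n k F \<Longrightarrow> b \<le> game_score n k Slow (insert A F)"
  shows "b \<le> game_score n k Fast F"
  using assms by (simp add: game_score_Fast finite_legal_moves)

text \<open>The bound on \<open>card F\<close> covers the position in which Slow has no legal move
  and the game is over.\<close>

lemma game_score_Slow_le:
  assumes "card F \<le> b"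
    and "\<And>A. A \<in> legal_moves n k F \<Longrightarrow> game_score n k Fast (insert A F) \<le> b"
  shows "game_score n k Slow F \<le> b"
proof (cases "legal_moves n k F = {}")
  case True
  then show ?thesis using assms(1) by (simp add: game_score_terminal)
next
  case False
  then show ?thesis using assms(2) by (simp add: game_score_Slow finite_legal_moves)
qed

text \<open>\<open>Min\<close> and \<open>Max\<close> over finitely many legal moves are attained,
  so following optimal moves leads to a maximal family whose size is the score. Both strategies are
  evaluated through properties of this final family.\<close>

lemma game_score_final:
  assumes "F \<in> intersecting_families n k"
  obtains F' where "F' \<in> intersecting_families n k" "F \<subseteq> F'" "legal_moves n k F' = {}"
    "game_score n k p F = card F'"
proof -
  have "\<exists>F'\<in>intersecting_families n k. F \<subseteq> F' \<and> legal_moves n k F' = {} \<and>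
      game_score n k p F = card F'"
    using assms
  proof (induction "card (ksubsets n k - F)" arbitrary: F p rule: less_induct)
    case less
    show ?case
    proof (cases "legal_moves n k F = {}")
      case True
      then show ?thesis using less.prems by (auto simp: game_score_terminal)
    next
      case False
      have "\<exists>A p'. A \<in> legal_moves n k F \<and> game_score n k p F = game_score n k p' (insert A F)"
      proof (cases p)
        case Fast
        have "game_score n k Fast F \<in> (\<lambda>A. game_score n k Slow (insert A F)) ` legal_moves n k F"
          unfolding game_score_Fast[OF False] using False
          by (intro Min_in) (simp_all add: finite_legal_moves)
        then show ?thesis using Fast by auto
      next
        case Slow
        have "game_score n k Slow F \<in> (\<lambda>A. game_score n k Fast (insert A F)) ` legal_moves n k F"
          unfolding game_score_Slow[OF False] using False
          by (intro Max_in) (simp_all add: finite_legal_moves)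
        then show ?thesis using Slow by auto
      qed
      then obtain A p' where A: "A \<in> legal_moves n k F"
        and eq: "game_score n k p F = game_score n k p' (insert A F)"
        by blast
      have "card (ksubsets n k - insert A F) < card (ksubsets n k - F)"
        using A by (intro psubset_card_mono) (auto simp: legal_moves_def finite_ksubsets)
      from less.hyps[OF this legal_movesD(1)[OF A], of p'] eq show ?thesis by auto
    qed
  qed
  with that show thesis by blast
qed

text \<open>The members of \<open>F\<close> cover at most \<open>k * card F\<close> points, so
  enough points of \<open>{1..n}\<close> remain untouched to pad \<open>K\<close> up to size
  \<open>k\<close>. The points of \<open>K\<close> alone secure the intersections with
  \<open>F\<close>. Every strategic move of either player has this shape.\<close>

lemma fresh_move:
  assumes F: "F \<in> intersecting_families n k"
    and K: "K \<subseteq> {1..n}" "card K < k" "\<And>A. A \<in> F \<Longrightarrow> A \<inter> K \<noteq> {}"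
    and n: "k * (card F + 1) \<le> n"
  obtains S where "S \<in> legal_moves n k F" "K \<subseteq> S" "S \<inter> \<Union>F \<subseteq> K"
proof -
  note fin = intersecting_family_finite[OF F]
  have finU: "finite (\<Union>F)" using fin intersecting_family_memberD(3)[OF F] by auto
  have finK: "finite K" using K(1) finite_subset by blast
  have "card (\<Union>F) \<le> (\<Sum>A\<in>F. card A)"
    by (rule card_Union_le_sum_card)
  also have "\<dots> = k * card F" using intersecting_family_memberD(2)[OF F] by simp
  finally have "card (\<Union>F \<union> K) \<le> k * card F + card K"
    using card_Un_le[of "\<Union>F" K] by linarith
  moreover have "card ({1..n} - (\<Union>F \<union> K)) \<ge> n - card (\<Union>F \<union> K)"
    using diff_card_le_card_Diff[of "\<Union>F \<union> K" "{1..n}"] finU finK by simp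
  ultimately have "k - card K \<le> card ({1..n} - (\<Union>F \<union> K))"
    using n by (simp add: algebra_simps)
  then obtain Z where Z: "Z \<subseteq> {1..n} - (\<Union>F \<union> K)" "card Z = k - card K"
    by (meson obtain_subset_with_card_n)
  have finZ: "finite Z" using Z(1) finite_subset by blast
  have "card (K \<union> Z) = k"
    using Z K(2) finK finZ by (subst card_Un_disjoint) auto
  with Z K(1) have S: "K \<union> Z \<in> ksubsets n k" by (auto simp: ksubsets_def)
  \<comment> \<open>Since \<open>card K < k\<close>, the fresh part is nonempty; this makes the set
    new and, even for empty \<open>K\<close>, lets it intersect itself.\<close>
  have "Z \<noteq> {}" using Z(2) K(2) by auto
  with Z(1) have "K \<union> Z \<notin> F" by blast
  moreover have "insert (K \<union> Z) F \<in> intersecting_families n k"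
    using F S K(3) \<open>Z \<noteq> {}\<close> unfolding intersecting_families_def intersecting_def by blast
  ultimately have "K \<union> Z \<in> legal_moves n k F" using S by (simp add: legal_moves_def)
  then show thesis using Z(1) by (intro that) auto
qed

lemma game_score_pos:
  assumes "0 < k" "k \<le> n"
  shows "1 \<le> game_score n k p {}"
proof -
  obtain S where S: "S \<in> legal_moves n k {}"
    using assms by (auto intro: fresh_move[OF empty_family, of "{}" n k])
  obtain F' where F': "F' \<in> intersecting_families n k" "legal_moves n k F' = {}"
    "game_score n k p {} = card F'"
    using game_score_final[OF empty_family] by metis
  have "F' \<noteq> {}" using S F'(2) by auto
  then have "card F' > 0" using intersecting_family_finite[OF F'(1)] by (simp add: card_gt_0_iff)
  with F'(3) show ?thesis by simp
qed

subsection \<open>Counting\<close>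

lemma card_ksubsets_supset:
  assumes "T \<subseteq> {1..n}" "card T \<le> k"
  shows "card {A \<in> ksubsets n k. T \<subseteq> A} = (n - card T) choose (k - card T)"
proof -
  have finT: "finite T" using assms(1) finite_subset by blast
  have "bij_betw (\<lambda>B. B \<union> T) {B. B \<subseteq> {1..n} - T \<and> card B = k - card T} {A \<in> ksubsets n k. T \<subseteq> A}"
  proof (rule bij_betw_byWitness[where f' = "\<lambda>A. A - T"])
    show "(\<lambda>B. B \<union> T) ` {B. B \<subseteq> {1..n} - T \<and> card B = k - card T} \<subseteq> {A \<in> ksubsets n k. T \<subseteq> A}"
    proof (rule image_subsetI)
      fix B assume B: "B \<in> {B. B \<subseteq> {1..n} - T \<and> card B = k - card T}"
      then have "finite B" using finite_subset by blast
      then have "card (B \<union> T) = k"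
        using B assms finT by (subst card_Un_disjoint) auto
      then show "B \<union> T \<in> {A \<in> ksubsets n k. T \<subseteq> A}"
        using B assms by (auto simp: ksubsets_def)
    qed
    show "(\<lambda>A. A - T) ` {A \<in> ksubsets n k. T \<subseteq> A} \<subseteq> {B. B \<subseteq> {1..n} - T \<and> card B = k - card T}"
      using finT by (auto simp: ksubsets_def card_Diff_subset)
  qed auto
  then have "card {A \<in> ksubsets n k. T \<subseteq> A} = card {B. B \<subseteq> {1..n} - T \<and> card B = k - card T}"
    by (rule bij_betw_same_card[symmetric])
  also have "\<dots> = (n - card T) choose (k - card T)"
    using assms finT by (simp add: n_subsets card_Diff_subset)
  finally show ?thesis .
qed

text \<open>As long as \<open>card T < t\<close>, some member \<open>B\<close> misses
  \<open>T\<close>, and every member containing \<open>T\<close> also contains one of the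
  \<open>k\<close> points of \<open>B\<close>, which can be added to \<open>T\<close>. This branches
  \<open>t - card T\<close> times by a factor \<open>k\<close>; afterwards at most
  \<open>n ^ (k - t)\<close> sets of size \<open>k\<close> contain the enlarged
  \<open>T\<close>.\<close>

lemma card_family_supset_le:
  assumes F: "F \<in> intersecting_families n k" and "t \<le> k"
    and tau: "\<And>T. finite T \<Longrightarrow> card T < t \<Longrightarrow> \<exists>A\<in>F. A \<inter> T = {}"
    and T: "T \<subseteq> {1..n}" "card T \<le> t"
  shows "card {A \<in> F. T \<subseteq> A} \<le> k ^ (t - card T) * n ^ (k - t)"
  using T
proof (induction "t - card T" arbitrary: T)
  case 0
  then have [simp]: "card T = t" by simp
  have "card {A \<in> F. T \<subseteq> A} \<le> card {A \<in> ksubsets n k. T \<subseteq> A}"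
    using F by (intro card_mono) (auto simp: intersecting_families_def finite_ksubsets)
  also have "\<dots> = (n - t) choose (k - t)"
    using card_ksubsets_supset[OF 0(2)] \<open>t \<le> k\<close> by simp
  also have "\<dots> \<le> n ^ (k - t)"
  proof (cases "k - t \<le> n - t")
    case True
    then have "(n - t) choose (k - t) \<le> (n - t) ^ (k - t)" by (rule binomial_le_pow)
    also have "\<dots> \<le> n ^ (k - t)" by (intro power_mono) auto
    finally show ?thesis .
  qed (simp add: binomial_eq_0)
  finally show ?case by simp
next
  case (Suc d)
  have finT: "finite T" using Suc.prems(1) finite_subset by blast
  have "card T < t" using Suc.hyps(2) by simp
  from tau[OF finT this] obtain B where B: "B \<in> F" "B \<inter> T = {}" by blast
  note BF = intersecting_family_memberD[OF F B(1)]
  have "{A \<in> F. T \<subseteq> A} \<subseteq> (\<Union>x\<in>B. {A \<in> F. insert x T \<subseteq> A})"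
    using intersecting_family_meet[OF F _ B(1)] by fastforce
  then have "card {A \<in> F. T \<subseteq> A} \<le> card (\<Union>x\<in>B. {A \<in> F. insert x T \<subseteq> A})"
    using BF(3) intersecting_family_finite[OF F] by (intro card_mono) auto
  also have "\<dots> \<le> (\<Sum>x\<in>B. card {A \<in> F. insert x T \<subseteq> A})"
    by (rule card_UN_le[OF BF(3)])
  also have "\<dots> \<le> (\<Sum>x\<in>B. k ^ d * n ^ (k - t))"
  proof (rule sum_mono)
    fix x assume "x \<in> B"
    then have c: "card (insert x T) = Suc (card T)" using B(2) finT by (auto intro!: card_insert_disjoint)
    have "d = t - card (insert x T)" using Suc.hyps(2) c by simp
    moreover have "insert x T \<subseteq> {1..n}" using \<open>x \<in> B\<close> BF(1) Suc.prems(1) by auto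
    moreover have "card (insert x T) \<le> t" using c \<open>card T < t\<close> by simp
    ultimately show "card {A \<in> F. insert x T \<subseteq> A} \<le> k ^ d * n ^ (k - t)"
      using Suc.hyps(1)[of "insert x T"] by metis
  qed
  also have "\<dots> = k ^ (t - card T) * n ^ (k - t)"
    using BF(2) Suc.hyps(2)[symmetric] by simp
  finally show ?case .
qed

lemma card_family_le:
  assumes "F \<in> intersecting_families n k" "t \<le> k"
    and "\<And>T. finite T \<Longrightarrow> card T < t \<Longrightarrow> \<exists>A\<in>F. A \<inter> T = {}"
  shows "card F \<le> k ^ t * n ^ (k - t)"
  using card_family_supset_le[OF assms, of "{}"] by simp

subsection \<open>A strategy for Fast\<close>

abbreviation multiplicity :: "'a set list \<Rightarrow> 'a \<Rightarrow> nat" where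
  "multiplicity gs x \<equiv> length (filter (\<lambda>A. x \<in> A) gs)"

text \<open>Double counting of the pairs of a point of \<open>T\<close> and a list entry containing
  it: every entry contributes at least one pair.\<close>

lemma length_le_sum_multiplicity:
  assumes "finite T" "\<And>A. A \<in> set gs \<Longrightarrow> A \<inter> T \<noteq> {}"
  shows "length gs \<le> (\<Sum>x\<in>T. multiplicity gs x)"
  using assms(2)
proof (induction gs)
  case (Cons A gs)
  have "(\<Sum>x\<in>T. multiplicity (A # gs) x) = (\<Sum>x\<in>T. multiplicity gs x + (if x \<in> A then 1 else 0))"
    by (intro sum.cong) auto
  also have "\<dots> = (\<Sum>x\<in>T. multiplicity gs x) + card (A \<inter> T)"
    using assms(1) by (simp add: sum.distrib sum.If_cases Int_commute)
  finally have "(\<Sum>x\<in>T. multiplicity (A # gs) x) = (\<Sum>x\<in>T. multiplicity gs x) + card (A \<inter> T)" .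
  moreover have "0 < card (A \<inter> T)" using Cons.prems assms(1) by (simp add: card_gt_0_iff)
  moreover have "length gs \<le> (\<Sum>x\<in>T. multiplicity gs x)" using Cons by simp
  ultimately show ?case unfolding list.size by linarith
qed simp

text \<open>A set \<open>T\<close> meets at most \<open>2 * card T\<close> entries of
  \<open>gs\<close>, fewer than \<open>length gs\<close> if \<open>card T < t\<close>. Hence the
  covering number of \<open>F\<close> is at least \<open>t\<close>.\<close>

lemma card_le_of_multiplicity_le_2:
  assumes "F \<in> intersecting_families n k" "set gs \<subseteq> F" "\<And>x. multiplicity gs x \<le> 2"
    and "t \<le> k" "2 * t \<le> length gs + 1"
  shows "card F \<le> k ^ t * n ^ (k - t)"
proof (rule card_family_le[OF assms(1,4)])
  fix T :: "nat set" assume T: "finite T" "card T < t"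
  show "\<exists>A\<in>F. A \<inter> T = {}"
  proof (rule ccontr)
    assume "\<not> ?thesis"
    then have "length gs \<le> (\<Sum>x\<in>T. multiplicity gs x)"
      using assms(2) by (intro length_le_sum_multiplicity T) auto
    also have "\<dots> \<le> (\<Sum>x\<in>T. 2)" by (intro sum_mono assms(3))
    also have "\<dots> = 2 * card T" by simp
    finally show False using T(2) assms(5) by simp
  qed
qed

text \<open>\<open>gs\<close> lists the sets whose multiplicities Fast controls, and
  \<open>m\<close> is the number of them aimed at. \<open>(m - 1) * (m - 2) < k\<close> keeps the
  doubly used points from exhausting a claimed set; \<open>2 * (m - 1) < k\<close> lets one point of
  every claimed set fit into the next set of Fast.\<close>

lemma Fast_strategy:
  assumes k: "0 < t" "t \<le> k" "0 < n" and m: "2 * t \<le> m + 1" "(m - 1) * (m - 2) < k" "2 * (m - 1) < k"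
    and n: "k * (2 * m + 1) \<le> n"
    and F: "F \<in> intersecting_families n k" "set gs \<subseteq> F" "\<And>x. multiplicity gs x \<le> 2"
      "card {x. multiplicity gs x = 2} \<le> length gs * (length gs - 1)" "card F \<le> 2 * length gs"
    and "length gs \<le> m"
  shows "game_score n k Fast F \<le> k ^ t * n ^ (k - t)"
  using F \<open>length gs \<le> m\<close>
proof (induction "m - length gs" arbitrary: F gs)
  case 0
  then have "length gs = m" by simp
  \<comment> \<open>All \<open>m\<close> sets are in place and stay in the final family, however
    play continues, so the covering bound applies to that family.\<close>
  obtain F' where "F' \<in> intersecting_families n k" "F \<subseteq> F'" "game_score n k Fast F = card F'"
    using game_score_final[OF 0(2)] by metis
  then show ?case
    using card_le_of_multiplicity_le_2[of F' n k gs t] 0(3,4) k(2) m(1) \<open>length gs = m\<close> by auto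
next
  case (Suc d)
  define i where "i = length gs"
  \<comment> \<open>The points that the next set of Fast must avoid.\<close>
  define D where "D = {x. multiplicity gs x = 2}"
  have i: "i \<le> m - 1" "i + 1 \<le> m" using Suc.hyps(2) by (auto simp: i_def)
  note FI = Suc.prems(1)
  note mem = intersecting_family_memberD[OF FI]
  have finD: "finite D"
  proof (rule finite_subset)
    show "D \<subseteq> \<Union>F"
    proof
      fix x assume "x \<in> D"
      then have "filter (\<lambda>A. x \<in> A) gs \<noteq> []" by (auto simp: D_def)
      then show "x \<in> \<Union>F" using Suc.prems(2) by (auto simp: filter_empty_conv)
    qed
  qed (use intersecting_family_finite[OF FI] mem in auto)
  have "card D \<le> i * (i - 1)" using Suc.prems(4) by (simp add: D_def i_def)
  also have "\<dots> \<le> (m - 1) * (m - 2)" using i by (intro mult_mono) auto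
  finally have cD: "card D < k" using m(2) by simp
  \<comment> \<open>As \<open>card D < k\<close>, no claimed set lies inside \<open>D\<close>;
    \<open>h\<close> picks an admissible point in each.\<close>
  have "\<exists>h. \<forall>A\<in>F. h A \<in> A - D"
  proof (rule bchoice, rule ballI)
    fix A assume "A \<in> F"
    then have "\<not> A \<subseteq> D" using mem(2)[of A] cD card_mono[OF finD, of A] by auto
    then show "\<exists>x. x \<in> A - D" by blast
  qed
  then obtain h where h: "h A \<in> A" "h A \<notin> D" if "A \<in> F" for A by blast
  have ch: "card (h ` F) \<le> 2 * i"
    using card_image_le[OF intersecting_family_finite[OF FI], of h] Suc.prems(5) by (simp add: i_def)
  have "k * (card F + 1) \<le> k * (2 * m + 1)"
    using Suc.prems(5) i unfolding i_def by (intro mult_left_mono) linarith+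
  then have "k * (card F + 1) \<le> n" using n by (rule le_trans)
  moreover have "card (h ` F) < k" using ch i m(3) by linarith
  moreover have "h ` F \<subseteq> {1..n}" using h(1) mem(1) by blast
  moreover have "A \<inter> h ` F \<noteq> {}" if "A \<in> F" for A using h(1) that by blast
  ultimately obtain G where G: "G \<in> legal_moves n k F" "h ` F \<subseteq> G" "G \<inter> \<Union>F \<subseteq> h ` F"
    using fresh_move[OF FI] by metis
  have old: "multiplicity gs x = 0" if "x \<notin> \<Union>F" for x
    using that Suc.prems(2) by (auto simp: filter_empty_conv)
  have GF: "insert G F \<in> intersecting_families n k" "G \<notin> F" using legal_movesD[OF G(1)] by auto
  have cG: "card (insert G F) = card F + 1"
    using GF(2) intersecting_family_finite[OF FI] by simp
  have mult: "multiplicity (G # gs) x \<le> 2" for x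
  proof (cases "x \<in> G")
    case True
    then have "x \<in> h ` F \<or> x \<notin> \<Union>F" using G(3) by blast
    moreover have "multiplicity gs x \<noteq> 2" if "x \<in> h ` F" using that h(2) by (auto simp: D_def)
    ultimately show ?thesis using True old[of x] Suc.prems(3)[of x] by force
  qed (use Suc.prems(3) in simp)
  \<comment> \<open>A point that becomes double lies in \<open>G\<close> and in an earlier set,
    hence is a value of \<open>h\<close>. There are at most \<open>2 * i\<close> of these, and
    \<open>i * (i - 1) + 2 * i = (i + 1) * i\<close> restores the invariant.\<close>
  have "{x. multiplicity (G # gs) x = 2} \<subseteq> D \<union> h ` F"
  proof
    fix x assume x: "x \<in> {x. multiplicity (G # gs) x = 2}"
    show "x \<in> D \<union> h ` F"
    proof (cases "x \<in> G")
      case True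
      then have "multiplicity gs x \<noteq> 0" using x by simp
      then have "x \<in> \<Union>F" using old by blast
      then show ?thesis using True G(3) by blast
    qed (use x in \<open>simp add: D_def\<close>)
  qed
  then have "card {x. multiplicity (G # gs) x = 2} \<le> card (D \<union> h ` F)"
    using finD intersecting_family_finite[OF FI] by (intro card_mono) auto
  also have "\<dots> \<le> i * (i - 1) + 2 * i"
    using card_Un_le[of D "h ` F"] ch \<open>card D \<le> i * (i - 1)\<close> by linarith
  also have "\<dots> = (i + 1) * i" by (cases i) auto
  finally have cD': "card {x. multiplicity (G # gs) x = 2} \<le> length (G # gs) * (length (G # gs) - 1)"
    by (simp add: i_def)
  show ?case
  proof (rule game_score_Fast_le[OF G(1)], rule game_score_Slow_le)
    \<comment> \<open>The game may stop right after \<open>G\<close>; the score is then at most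
      \<open>k\<close>, which stays within the bound because \<open>0 < t\<close> and
      \<open>0 < n\<close>.\<close>
    have "card (insert G F) \<le> k" using cG Suc.prems(5) i m(3) by (simp add: i_def)
    also have "k \<le> k ^ t * n ^ (k - t)"
      using k by (metis le_trans mult_le_mono self_le_power one_le_power Suc_leI One_nat_def
          mult.right_neutral order_less_le_trans)
    finally show "card (insert G F) \<le> k ^ t * n ^ (k - t)" .
  next
    fix S assume S: "S \<in> legal_moves n k (insert G F)"
    have "card (insert S (insert G F)) \<le> card F + 2"
      using cG by (metis card_insert_le_m1 card_insert_if intersecting_family_finite[OF GF(1)]
          add_Suc_right le_refl Suc_eq_plus1 one_add_one add.assoc le_SucI)
    then show "game_score n k Fast (insert S (insert G F)) \<le> k ^ t * n ^ (k - t)"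
      using Suc.hyps(2) Suc.prems(2,5) mult cD' i legal_movesD(1)[OF S]
      by (intro Suc.hyps(1)[of "G # gs"]) (auto simp: i_def)
  qed
qed

lemma gsat_le:
  assumes "0 < t" "t \<le> k" "2 * t \<le> m + 1" "(m - 1) * (m - 2) < k" "2 * (m - 1) < k"
    and n: "k * (2 * m + 1) \<le> n" "0 < n" and "1 \<le> m"
  shows "gsat_F n k \<le> k ^ t * n ^ (k - t)" "gsat_S n k \<le> k ^ t * n ^ (k - t)"
proof -
  show "gsat_F n k \<le> k ^ t * n ^ (k - t)"
    unfolding gsat_F_def by (rule Fast_strategy[where gs = "[]" and m = m]) (use assms empty_family in auto)
  show "gsat_S n k \<le> k ^ t * n ^ (k - t)"
    unfolding gsat_S_def
  proof (rule game_score_Slow_le)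
    fix S assume "S \<in> legal_moves n k {}"
    then have "{S} \<in> intersecting_families n k" by (rule legal_movesD)
    \<comment> \<open>The opening set of Slow is entered into \<open>gs\<close> as if it belonged to
      Fast, which gives \<open>card F \<le> 2 * length gs\<close> from the start.\<close>
    then show "game_score n k Fast {S} \<le> k ^ t * n ^ (k - t)"
      by (intro Fast_strategy[where gs = "[S]" and m = m])
        (use assms in \<open>auto simp: if_distrib cong: if_cong\<close>)
  qed simp
qed

subsection \<open>A strategy for Slow\<close>

text \<open>Slow tries to turn \<open>K\<close> into a cover of all sets that can ever be claimed: once more than \<open>k\<close>
  sets of \<open>\<S>\<close> have been claimed, a \<open>k\<close>-set avoiding \<open>K\<close> cannot meet all of them. A set of Fast
  avoiding \<open>K\<close> must meet \<open>C\<close> outside \<open>K\<close>; the points \<open>\<Union>\<S> \<inter> C - K\<close> are those that Slow has already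
  used there, and each of them pays for a later growth of \<open>K\<close>. The slack \<open>e\<close> is 0 if Fast is to move
  and 1 if Slow is to move.\<close>

definition kernel_state ::
  "nat \<Rightarrow> nat \<Rightarrow> nat \<Rightarrow> nat set \<Rightarrow> nat set set \<Rightarrow> nat set \<Rightarrow> nat set set \<Rightarrow> bool" where
  "kernel_state n k e K \<S> C F \<longleftrightarrow>
     F \<in> intersecting_families n k \<and> C \<in> F \<and> \<S> \<subseteq> F \<and> K \<subseteq> {1..n} \<and>
     (\<forall>A\<in>F. A \<inter> K \<noteq> {}) \<and> (\<forall>A\<in>\<S>. \<forall>B\<in>\<S>. A \<noteq> B \<longrightarrow> A \<inter> B \<subseteq> K) \<and>
     3 * card K + card (\<Union>\<S> \<inter> C - K) \<le> 2 * card \<S> + 3 + 2 * e \<and>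
     card F \<le> 2 * card \<S> + 2 + e"

text \<open>Outside \<open>K\<close> the members of \<open>\<S>\<close> are pairwise disjoint. If
  \<open>A\<close> avoided \<open>K\<close>, choosing a point of \<open>A\<close> in each of them
  would inject \<open>\<S>\<close> into \<open>A\<close>, which has too few points.\<close>

lemma kernel_state_cover:
  assumes "kernel_state n k e K \<S> C F" "k < card \<S>" "card A \<le> k" "finite A"
    and "\<And>B. B \<in> \<S> \<Longrightarrow> A \<inter> B \<noteq> {}"
  shows "A \<inter> K \<noteq> {}"
proof
  assume disj: "A \<inter> K = {}"
  obtain f where f: "f B \<in> A \<inter> B" if "B \<in> \<S>" for B
    using assms(5) bchoice[of \<S> "\<lambda>B x. x \<in> A \<inter> B"] by blast
  have "inj_on f \<S>"
  proof (rule inj_onI, rule ccontr)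
    fix B B' assume *: "B \<in> \<S>" "B' \<in> \<S>" "f B = f B'" "B \<noteq> B'"
    then have "f B \<in> B \<inter> B'" using f by (metis IntD2 IntI)
    moreover have "B \<inter> B' \<subseteq> K" using assms(1) * by (simp add: kernel_state_def)
    ultimately have "f B \<in> K" by blast
    then show False using f[OF *(1)] disj by blast
  qed
  then have "card \<S> \<le> card A" using f assms(4) by (intro card_inj_on_le) auto
  then show False using assms(2,3) by simp
qed

text \<open>Every set in the final family now meets \<open>K\<close>, so a \<open>k\<close>-set
  containing \<open>K\<close> intersects all of them, and maximality forces it into the
  family.\<close>

lemma kernel_state_final:
  assumes st: "kernel_state n k e K \<S> C F" and "k < card \<S>"
  shows "card {A \<in> ksubsets n k. K \<subseteq> A} \<le> game_score n k p F"
proof -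
  have F: "F \<in> intersecting_families n k" "\<S> \<subseteq> F" "C \<in> F" "\<forall>A\<in>F. A \<inter> K \<noteq> {}"
    using st by (auto simp: kernel_state_def)
  obtain F' where F': "F' \<in> intersecting_families n k" "F \<subseteq> F'" "legal_moves n k F' = {}"
    "game_score n k p F = card F'"
    using game_score_final[OF F(1)] by metis
  have cover: "A \<inter> K \<noteq> {}" if "A \<in> F'" for A
    using intersecting_family_memberD[OF F'(1) that] intersecting_family_meet[OF F'(1) that] F(2) F'(2)
    by (intro kernel_state_cover[OF assms]) auto
  have "{A \<in> ksubsets n k. K \<subseteq> A} \<subseteq> F'"
  proof (rule subsetI, rule ccontr)
    fix A assume A: "A \<in> {A \<in> ksubsets n k. K \<subseteq> A}" "A \<notin> F'"
    \<comment> \<open>Needed so that a set containing \<open>K\<close> intersects itself;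
      \<open>C\<close> provides a member of \<open>F\<close> that meets \<open>K\<close>.\<close>
    have "K \<noteq> {}" using F(3,4) by auto
    then have "A \<noteq> {}" using A(1) by auto
    have "A \<inter> B \<noteq> {}" "B \<inter> A \<noteq> {}" if "B \<in> F'" for B
      using cover[OF that] A(1) by auto
    with \<open>A \<noteq> {}\<close> have "insert A F' \<in> intersecting_families n k"
      using A(1) F'(1) by (simp add: intersecting_families_def intersecting_def)
    then have "A \<in> legal_moves n k F'" using A by (simp add: legal_moves_def)
    then show False using F'(3) by simp
  qed
  then have "card {A \<in> ksubsets n k. K \<subseteq> A} \<le> card F'"
    by (intro card_mono intersecting_family_finite[OF F'(1)])
  then show ?thesis using F'(4) by simp
qed

text \<open>The standard reply of Slow is \<open>K\<close> padded with fresh points. It touches no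
  new point of \<open>C\<close> and leaves \<open>K\<close> unchanged, while the new member of
  \<open>\<S>\<close> pays for the drop of the slack from 1 to 0.\<close>

lemma kernel_state_extend:
  assumes st: "kernel_state n k 1 K \<S> C F" and k: "card \<S> \<le> k + 1" "8 \<le> k" "k * (2 * k + 10) \<le> n"
  obtains S where "S \<in> legal_moves n k F" "kernel_state n k 0 K (insert S \<S>) C (insert S F)"
    "card (insert S \<S>) = card \<S> + 1"
proof -
  have F: "F \<in> intersecting_families n k" "C \<in> F" "\<S> \<subseteq> F" "K \<subseteq> {1..n}"
     "\<And>A. A \<in> F \<Longrightarrow> A \<inter> K \<noteq> {}" "\<forall>A\<in>\<S>. \<forall>B\<in>\<S>. A \<noteq> B \<longrightarrow> A \<inter> B \<subseteq> K"
     "3 * card K + card (\<Union>\<S> \<inter> C - K) \<le> 2 * card \<S> + 5"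
     "card F \<le> 2 * card \<S> + 3"
    using st by (auto simp: kernel_state_def)
  \<comment> \<open>The invariant gives \<open>3 * card K \<le> 2 * k + 7\<close>, which is below
    \<open>3 * k\<close> once \<open>8 \<le> k\<close>.\<close>
  have "card K < k" using F(7) k by linarith
  have "k * (card F + 1) \<le> k * (2 * k + 10)" using F(8) k(1) by (intro mult_left_mono) auto
  then obtain S where S: "S \<in> legal_moves n k F" "K \<subseteq> S" "S \<inter> \<Union>F \<subseteq> K"
    using fresh_move[OF F(1,4) \<open>card K < k\<close> F(5)] k(3) by (metis le_trans)
  note SF = legal_movesD[OF S(1)]
  have fin: "finite F" using intersecting_family_finite[OF F(1)] .
  have c: "card (insert S \<S>) = card \<S> + 1" "card (insert S F) = card F + 1"
    using F(3) SF(2) fin finite_subset[OF F(3) fin] by (auto intro!: card_insert_disjoint)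
  have "S \<inter> K \<noteq> {}" using S(2) F(2,5) by blast
  moreover have "\<Union>(insert S \<S>) \<inter> C - K = \<Union>\<S> \<inter> C - K" using S(3) F(2) by blast
  moreover have "\<forall>A\<in>insert S \<S>. \<forall>B\<in>insert S \<S>. A \<noteq> B \<longrightarrow> A \<inter> B \<subseteq> K"
    using F(3,6) S(3) by blast
  ultimately have "kernel_state n k 0 K (insert S \<S>) C (insert S F)"
    unfolding kernel_state_def using SF F c by auto
  with S(1) c(1) that show thesis by blast
qed

text \<open>While \<open>card \<S> \<le> k\<close>, a round adds one or two sets to
  \<open>\<S>\<close>, so the count never passes \<open>k + 2\<close>. The invariant then yields
  \<open>3 * card K \<le> 2 * (k + 2) + 3\<close>, the size for which \<open>b\<close> is assumed to
  be a lower bound.\<close>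

lemma Slow_strategy:
  assumes k: "8 \<le> k" "k * (2 * k + 10) \<le> n"
    and b: "\<And>K. K \<subseteq> {1..n} \<Longrightarrow> 3 * card K \<le> 2 * k + 7 \<Longrightarrow> b \<le> card {A \<in> ksubsets n k. K \<subseteq> A}"
  shows "kernel_state n k 0 K \<S> C F \<Longrightarrow> card \<S> \<le> k + 2 \<Longrightarrow> b \<le> game_score n k Fast F"
    and "kernel_state n k 1 K \<S> C F \<Longrightarrow> card \<S> \<le> k + 1 \<Longrightarrow> b \<le> game_score n k Slow F"
proof -
  \<comment> \<open>The standard reply, with the continuation left open as a hypothesis, so that it
    serves both inside the induction and after it.\<close>
  have slow: "b \<le> game_score n k Slow F"
    if st: "kernel_state n k 1 K \<S> C F" "card \<S> \<le> k + 1"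
      and fast: "\<And>S. card (insert S \<S>) = card \<S> + 1 \<Longrightarrow>
        kernel_state n k 0 K (insert S \<S>) C (insert S F) \<Longrightarrow> b \<le> game_score n k Fast (insert S F)"
    for K \<S> C F
  proof -
    obtain S where S: "S \<in> legal_moves n k F" "kernel_state n k 0 K (insert S \<S>) C (insert S F)"
      "card (insert S \<S>) = card \<S> + 1"
      using kernel_state_extend[OF st k] .
    then show ?thesis by (intro game_score_Slow_ge[OF S(1)] fast)
  qed
  show fast: "b \<le> game_score n k Fast F" if "kernel_state n k 0 K \<S> C F" "card \<S> \<le> k + 2"
    for K \<S> C F
    using that
  proof (induction "k + 2 - card \<S>" arbitrary: K \<S> F rule: less_induct)
    case less
    note st = less.prems(1)
    have F: "F \<in> intersecting_families n k" "C \<in> F" "\<S> \<subseteq> F" "K \<subseteq> {1..n}"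
     "\<And>A. A \<in> F \<Longrightarrow> A \<inter> K \<noteq> {}" "\<forall>A\<in>\<S>. \<forall>B\<in>\<S>. A \<noteq> B \<longrightarrow> A \<inter> B \<subseteq> K"
     "3 * card K + card (\<Union>\<S> \<inter> C - K) \<le> 2 * card \<S> + 3"
     "card F \<le> 2 * card \<S> + 2"
      using st by (auto simp: kernel_state_def)
    note fin = intersecting_family_finite[OF F(1)]
    have finK: "finite K" using F(4) finite_subset by blast
    have finY: "finite (\<Union>\<S> \<inter> C - K)" using intersecting_family_memberD(3)[OF F(1,2)] by blast
    show ?case
    proof (cases "k < card \<S>")
      case True
      have "b \<le> card {A \<in> ksubsets n k. K \<subseteq> A}"
        using F(4,7) less.prems(2) by (intro b) auto
      with kernel_state_final[OF st True] show ?thesis using le_trans by blast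
    next
      case False
      have room: "k * (j + 1) \<le> n" if "j \<le> 2 * card \<S> + 5" for j
      proof -
        have "k * (j + 1) \<le> k * (2 * k + 10)" using that False by (intro mult_left_mono) auto
        then show ?thesis using k(2) by simp
      qed
      have cK: "card K + 1 < k" using F(7) k(1) False by linarith
      have IH: "b \<le> game_score n k Fast F'"
        if "kernel_state n k 0 K' \<S>' C F'" "card \<S> < card \<S>'" "card \<S>' \<le> k + 2" for K' \<S>' F'
        using that False by (intro less.hyps[of \<S>' K' F']) linarith+
      show ?thesis
      proof (rule game_score_Fast_ge)
        \<comment> \<open>The game cannot end prematurely here: \<open>K\<close> with fresh points
          is still a legal move.\<close>
        have "k * (card F + 1) \<le> n" using F(8) by (intro room) simp
        moreover have "card K < k" using cK by simp
        ultimately obtain S where "S \<in> legal_moves n k F"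
          using F(5) by - (rule fresh_move[OF F(1,4)])
        then show "legal_moves n k F \<noteq> {}" by blast
      next
        fix G assume G: "G \<in> legal_moves n k F"
        note GF = legal_movesD[OF G]
        have Gmeet: "G \<inter> A \<noteq> {}" if "A \<in> F" for A
          using intersecting_family_meet[OF GF(1), of G A] that by simp
        have Gsub: "G \<subseteq> {1..n}" using intersecting_family_memberD(1)[OF GF(1), of G] by simp
        have cG: "card (insert G F) = card F + 1" using GF(2) fin by simp
        consider (meets) "G \<inter> K \<noteq> {}" | (used) "G \<inter> K = {}" "G \<inter> C \<subseteq> \<Union>\<S>"
          | (unused) y where "G \<inter> K = {}" "y \<in> G" "y \<in> C" "y \<notin> \<Union>\<S>"
          by blast
        then show "b \<le> game_score n k Slow (insert G F)"
        proof cases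
          case meets
          then have "kernel_state n k 1 K \<S> C (insert G F)"
            unfolding kernel_state_def using F GF cG by auto
          then show ?thesis
          proof (rule slow)
            fix S assume st: "kernel_state n k 0 K (insert S \<S>) C (insert S (insert G F))"
              and c: "card (insert S \<S>) = card \<S> + 1"
            from st show "b \<le> game_score n k Fast (insert S (insert G F))"
              by (rule IH) (use False c in linarith)+
          qed (use False in simp)
        next
          case used
          obtain x where x: "x \<in> G" "x \<in> C" using Gmeet[OF F(2)] by blast
          then have xY: "x \<in> \<Union>\<S> \<inter> C - K" using used by blast
          \<comment> \<open>Moving \<open>x\<close> from the used points of \<open>C\<close> into
            \<open>K\<close> changes the weighted count by \<open>3 - 1 = 2\<close>, exactly the
            slack granted on the turn of Slow.\<close>
          have "\<Union>\<S> \<inter> C - insert x K = (\<Union>\<S> \<inter> C - K) - {x}" by blast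
          then have "card (\<Union>\<S> \<inter> C - insert x K) + 1 = card (\<Union>\<S> \<inter> C - K)"
            using xY finY by (metis card_Suc_Diff1 Suc_eq_plus1)
          moreover have "card (insert x K) = card K + 1" using xY finK by simp
          ultimately have "kernel_state n k 1 (insert x K) \<S> C (insert G F)"
            unfolding kernel_state_def
          proof (intro conjI)
            show "\<forall>A\<in>\<S>. \<forall>B\<in>\<S>. A \<noteq> B \<longrightarrow> A \<inter> B \<subseteq> insert x K" using F(6) by blast
          qed (use F(1-5,7,8) GF cG x Gsub in auto)
          then show ?thesis
          proof (rule slow)
            fix S assume st: "kernel_state n k 0 (insert x K) (insert S \<S>) C (insert S (insert G F))"
              and c: "card (insert S \<S>) = card \<S> + 1"
            from st show "b \<le> game_score n k Fast (insert S (insert G F))"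
              by (rule IH) (use False c in linarith)+
          qed (use False in simp)
        next
          case unused
          \<comment> \<open>Slow postpones the growth of \<open>K\<close>: her set meets
            \<open>G\<close> in \<open>y\<close>, and the invariant is suspended, since
            \<open>G\<close> avoids \<open>K\<close>, until the next set of Fast is known.\<close>
          have yK: "y \<notin> K" using unused by blast
          have sub: "insert y K \<subseteq> {1..n}" using unused(2) Gsub F(4) by blast
          have small: "card (insert y K) < k" using cK finK yK by simp
          have meet1: "A \<inter> insert y K \<noteq> {}" if "A \<in> insert G F" for A
            using that unused(2) F(5) by blast
          have "k * (card (insert G F) + 1) \<le> n" using cG F(8) by (intro room) simp
          then obtain S where S: "S \<in> legal_moves n k (insert G F)" "insert y K \<subseteq> S"
            "S \<inter> \<Union>(insert G F) \<subseteq> insert y K"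
            by - (rule fresh_move[OF GF(1) sub small meet1])
          note SF = legal_movesD[OF S(1)]
          define F1 where "F1 = insert S (insert G F)"
          have F1: "F1 \<in> intersecting_families n k" using SF by (simp add: F1_def)
          have cF1: "card F1 = card F + 2"
            using SF(2) cG fin by (simp add: F1_def)
          have cS: "card (insert S \<S>) = card \<S> + 1"
            using SF(2) F(3) finite_subset[OF F(3) fin] by (subst card_insert_disjoint) auto
          show ?thesis
          proof (rule game_score_Slow_ge[OF S(1)], fold F1_def, rule game_score_Fast_ge)
            have "A \<inter> insert y K \<noteq> {}" if "A \<in> F1" for A
              using that meet1 S(2) by (auto simp: F1_def)
            moreover have "k * (card F1 + 1) \<le> n" using cF1 F(8) by (intro room) simp
            ultimately obtain S' where "S' \<in> legal_moves n k F1"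
              by - (rule fresh_move[OF F1 sub small])
            then show "legal_moves n k F1 \<noteq> {}" by blast
          next
            fix G' assume G': "G' \<in> legal_moves n k F1"
            note GF' = legal_movesD[OF G']
            \<comment> \<open>The new kernel point must lie in \<open>G\<close>, which
              \<open>K\<close> still misses. If \<open>G'\<close> avoids \<open>K\<close> too, a
              common point of both serves; otherwise any point of \<open>G\<close> will do, such as
              \<open>y\<close>.\<close>
            have "\<exists>x. x \<in> G \<and> x \<notin> K \<and> G' \<inter> insert x K \<noteq> {}"
            proof (cases "G' \<inter> K = {}")
              case True
              have "G' \<inter> G \<noteq> {}"
                using intersecting_family_meet[OF GF'(1), of G' G] by (simp add: F1_def)
              then show ?thesis using True by blast
            next
              case False
              then show ?thesis using unused(2) yK by blast
            qed
            then obtain x where x: "x \<in> G" "x \<notin> K" "G' \<inter> insert x K \<noteq> {}" by blast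
            \<comment> \<open>Apart from points of \<open>K\<close>, the set \<open>S\<close> meets
              the earlier sets at most in \<open>y\<close>, so at most one further point of
              \<open>C\<close> becomes used.\<close>
            have "\<Union>(insert S \<S>) \<inter> C - insert x K \<subseteq> insert y (\<Union>\<S> \<inter> C - K)"
              using S(3) F(2) by blast
            then have "card (\<Union>(insert S \<S>) \<inter> C - insert x K) \<le> card (insert y (\<Union>\<S> \<inter> C - K))"
              using finY by (intro card_mono) auto
            also have "\<dots> \<le> card (\<Union>\<S> \<inter> C - K) + 1"
              using card_insert_le_m1 finY by (simp add: card_insert_if)
            finally have cY: "card (\<Union>(insert S \<S>) \<inter> C - insert x K) \<le> card (\<Union>\<S> \<inter> C - K) + 1" .
            have cK': "card (insert x K) = card K + 1" using x(2) finK by simp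
            have cG': "card (insert G' F1) = card F + 3"
              using GF'(2) cF1 intersecting_family_finite[OF F1] by simp
            have "S \<inter> K \<noteq> {}" using S(2) F(2,5) by blast
            then have all: "\<forall>A\<in>insert G' F1. A \<inter> insert x K \<noteq> {}"
              using x F(5) by (auto simp: F1_def)
            \<comment> \<open>This is why \<open>y\<close> was chosen outside
              \<open>\<Union>\<S>\<close>: it creates no overlap with earlier sets of Slow.\<close>
            have "A \<inter> S \<subseteq> K" if "A \<in> \<S>" for A
              using S(3) that F(3) unused(4) by blast
            then have disj: "\<forall>A\<in>insert S \<S>. \<forall>B\<in>insert S \<S>. A \<noteq> B \<longrightarrow> A \<inter> B \<subseteq> insert x K"
              using F(6) by blast
            have "kernel_state n k 1 (insert x K) (insert S \<S>) C (insert G' F1)"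
              unfolding kernel_state_def
            proof (intro conjI)
              show "insert S \<S> \<subseteq> insert G' F1" "C \<in> insert G' F1" using F(2,3) by (auto simp: F1_def)
              show "insert x K \<subseteq> {1..n}" using x(1) Gsub F(4) by blast
              \<comment> \<open>The cost is 3 for \<open>x\<close> and at most 1 for
                \<open>y\<close>; it is covered by 2 for the new member \<open>S\<close> and the
                slack 2 of the turn of Slow.\<close>
              show "3 * card (insert x K) + card (\<Union>(insert S \<S>) \<inter> C - insert x K)
                  \<le> 2 * card (insert S \<S>) + 3 + 2 * 1"
                using cY cK' cS F(7) by linarith
              show "card (insert G' F1) \<le> 2 * card (insert S \<S>) + 2 + 1"
                using cG' cS F(8) by linarith
            qed (fact GF'(1) all disj)+
            then show "b \<le> game_score n k Slow (insert G' F1)"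
            proof (rule slow)
              fix S' assume st': "kernel_state n k 0 (insert x K) (insert S' (insert S \<S>)) C (insert S' (insert G' F1))"
                and c: "card (insert S' (insert S \<S>)) = card (insert S \<S>) + 1"
              from st' show "b \<le> game_score n k Fast (insert S' (insert G' F1))"
                by (rule IH) (use False cS c in linarith)+
            qed (use False cS in simp)
          qed
        qed
      qed
    qed
  qed
  show "b \<le> game_score n k Slow F" if "kernel_state n k 1 K \<S> C F" "card \<S> \<le> k + 1"
    using that
  proof (rule slow)
    fix S assume st: "kernel_state n k 0 K (insert S \<S>) C (insert S F)"
      and c: "card (insert S \<S>) = card \<S> + 1"
    from st show "b \<le> game_score n k Fast (insert S F)"
      by (rule fast) (use that(2) c in linarith)
  qed
qed

lemma gsat_ge:
  assumes k: "8 \<le> k" "k * (2 * k + 10) \<le> n"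
    and b: "\<And>K. K \<subseteq> {1..n} \<Longrightarrow> 3 * card K \<le> 2 * k + 7 \<Longrightarrow> b \<le> card {A \<in> ksubsets n k. K \<subseteq> A}"
  shows "b \<le> gsat_F n k" "b \<le> gsat_S n k"
proof -
  have "k * 1 \<le> k * (2 * k + 10)" by (intro mult_left_mono) auto
  then have kn: "k \<le> n" using k(2) unfolding mult_1_right by (rule le_trans)
  \<comment> \<open>Whoever opens, the first set becomes \<open>C\<close> and is not counted in
    \<open>\<S>\<close>; the one-point kernel is paid by the constant 3 in the invariant.\<close>
  have single: "kernel_state n k e {x} {} S {S}" if "S \<in> legal_moves n k {}" "x \<in> S" for e x S
    using legal_movesD(1)[OF that(1)] that intersecting_family_memberD(1)[OF legal_movesD(1)[OF that(1)], of S]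
    by (auto simp: kernel_state_def)
  have mem: "S \<noteq> {}" if "S \<in> legal_moves n k {}" for S
    using intersecting_family_meet[OF legal_movesD(1)[OF that]] by auto
  obtain S where S: "S \<in> legal_moves n k {}"
    using kn k by (auto intro: fresh_move[OF empty_family, of "{}" n k])
  show "b \<le> gsat_F n k"
    unfolding gsat_F_def
  proof (rule game_score_Fast_ge)
    fix G assume "G \<in> legal_moves n k {}"
    then obtain x where "x \<in> G" "kernel_state n k 1 {x} {} G {G}" using mem single by blast
    then show "b \<le> game_score n k Slow {G}" by (intro Slow_strategy(2)[OF assms]) auto
  qed (use S in blast)
  obtain x where "x \<in> S" using mem[OF S] by blast
  from single[OF S this] show "b \<le> gsat_S n k"
    unfolding gsat_S_def
    by (intro game_score_Slow_ge[OF S] Slow_strategy(1)[OF assms]) auto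
qed

subsection \<open>The asymptotic bounds\<close>

text \<open>For \<open>k > 4\<close>, take \<open>m\<close> as \<open>sqrt k\<close> rounded up and
  \<open>t\<close> as \<open>m / 2\<close> rounded up; \<open>m - 1 < sqrt k\<close> gives both
  strict bounds. Small \<open>k\<close> is separate: for \<open>k = 2\<close> this choice has
  \<open>m = 2\<close>, violating \<open>2 * (m - 1) < k\<close>.\<close>

lemma Fast_parameters:
  assumes "2 \<le> k"
  obtains t m where "0 < t" "t \<le> k" "1 \<le> m" "2 * t \<le> m + 1" "(m - 1) * (m - 2) < k"
    "2 * (m - 1) < k" "sqrt (real k) \<le> 2 * real t"
proof (cases "k \<le> 4")
  case True
  have "sqrt (real k) \<le> sqrt (2\<^sup>2)" using True by (intro real_sqrt_le_mono) simp
  then have "sqrt (real k) \<le> 2" by simp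
  then show thesis using assms by (intro that[of 1 1]) auto
next
  case False
  define m where "m = nat \<lceil>sqrt (real k)\<rceil>"
  define a where "a = m - 1"
  have m: "sqrt (real k) \<le> real m" "real m < sqrt (real k) + 1"
    unfolding m_def using real_sqrt_ge_zero[of "real k"] by linarith+
  moreover have "0 < sqrt (real k)" using False by simp
  ultimately have ma: "m = a + 1" unfolding a_def by (cases m) auto
  then have "real a < sqrt (real k)" using m(2) by simp
  then have "(real a)\<^sup>2 < real k" by (metis of_nat_0_le_iff real_less_rsqrt not_le real_le_lsqrt real_sqrt_le_iff real_sqrt_power)
  then have ak: "a * a < k" by (metis of_nat_less_iff of_nat_power power2_eq_square)
  have "a * (a - 1) \<le> a * a" by simp
  also note ak
  finally have 1: "(m - 1) * (m - 2) < k" using ma by simp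
  have 2: "2 * a < k"
  proof (cases "a \<le> 2")
    case False
    then have "2 * a \<le> a * a" by (intro mult_right_mono) auto
    then show ?thesis using ak by (rule le_less_trans)
  qed (use \<open>\<not> k \<le> 4\<close> in simp)
  define t where "t = (m + 1) div 2"
  have "m \<le> 2 * t" by (simp add: t_def)
  then have "sqrt (real k) \<le> 2 * real t" using m(1) by linarith
  then show thesis using 1 2 ma False by (intro that[of t m]) (auto simp: t_def)
qed

lemma gsat_bigo:
  assumes "2 \<le> k"
  shows "(\<lambda>n. real (gsat_F n k)) \<in> O(\<lambda>n. real n powr (real k - sqrt (real k) / 2))"
    and "(\<lambda>n. real (gsat_S n k)) \<in> O(\<lambda>n. real n powr (real k - sqrt (real k) / 2))"
proof -
  obtain t m where tm: "0 < t" "t \<le> k" "1 \<le> m" "2 * t \<le> m + 1" "(m - 1) * (m - 2) < k"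
    "2 * (m - 1) < k" "sqrt (real k) \<le> 2 * real t"
    using Fast_parameters[OF assms] .
  have bigo: "(\<lambda>n. real (f n)) \<in> O(\<lambda>n. real n powr (real k - sqrt (real k) / 2))"
    if f: "\<And>n. k * (2 * m + 1) \<le> n \<Longrightarrow> 0 < n \<Longrightarrow> f n \<le> k ^ t * n ^ (k - t)" for f
  proof (rule landau_o.bigI[where c = "real k ^ t"])
    show "\<forall>\<^sub>F n in sequentially.
      norm (real (f n)) \<le> real k ^ t * norm (real n powr (real k - sqrt (real k) / 2))"
      using eventually_ge_at_top[of "k * (2 * m + 1)"] eventually_gt_at_top[of 0]
    proof eventually_elim
      case (elim n)
      have "real (f n) \<le> real (k ^ t * n ^ (k - t))" using f[OF elim] by (simp only: of_nat_le_iff)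
      also have "\<dots> = real k ^ t * real n powr real (k - t)"
        using elim(2) by (simp add: powr_realpow)
      also have "\<dots> \<le> real k ^ t * real n powr (real k - sqrt (real k) / 2)"
        using elim(2) tm by (intro mult_left_mono powr_mono) (auto simp: of_nat_diff)
      finally show ?case by simp
    qed
  qed (use assms in simp)
  show "(\<lambda>n. real (gsat_F n k)) \<in> O(\<lambda>n. real n powr (real k - sqrt (real k) / 2))"
    by (rule bigo, rule gsat_le(1)[where m = m]) (use tm in simp_all)
  show "(\<lambda>n. real (gsat_S n k)) \<in> O(\<lambda>n. real n powr (real k - sqrt (real k) / 2))"
    by (rule bigo, rule gsat_le(2)[where m = m]) (use tm in simp_all)
qed

text \<open>The exponent comes from \<open>k - card K \<ge> (k - 7) / 3\<close>. With
  \<open>c = card K\<close>, the binomial coefficient is at least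
  \<open>((n - c) / (k - c)) ^ (k - c)\<close>, and subtracting \<open>c\<close> from both terms of
  \<open>n / k\<close> does not decrease the quotient when \<open>k \<le> n\<close>.\<close>

lemma card_ksubsets_supset_ge:
  assumes "18 \<le> k" "k \<le> n" "K \<subseteq> {1..n}" "3 * card K \<le> 2 * k + 7"
  shows "(n div k) ^ (k div 3 - 5) \<le> card {A \<in> ksubsets n k. K \<subseteq> A}"
proof -
  define c where "c = card K"
  have c: "c < k" "k div 3 - 5 \<le> k - c" using assms by (auto simp: c_def)
  have "1 \<le> n div k" using assms by (simp add: div_greater_zero_iff Suc_leI)
  then have "real ((n div k) ^ (k div 3 - 5)) \<le> real (n div k) ^ (k - c)"
    using c by (simp add: power_increasing)
  also have "\<dots> \<le> (real n / real k) ^ (k - c)"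
    by (intro power_mono of_nat_div_le_of_nat) auto
  also have "\<dots> \<le> (real (n - c) / real (k - c)) ^ (k - c)"
  proof (intro power_mono)
    have "real n * (real k - real c) \<le> (real n - real c) * real k"
      using assms(2) by (simp add: algebra_simps mult_left_mono)
    then show "real n / real k \<le> real (n - c) / real (k - c)"
      using c assms by (simp add: field_simps of_nat_diff)
  qed simp
  also have "\<dots> \<le> real ((n - c) choose (k - c))"
    using assms(2) by (intro binomial_ge_n_over_k_pow_k) simp
  also have "\<dots> = real (card {A \<in> ksubsets n k. K \<subseteq> A})"
    using c assms(3) by (simp add: card_ksubsets_supset c_def)
  finally show ?thesis by (simp only: of_nat_le_iff)
qed

lemma gsat_bigomega:
  assumes "2 \<le> k"
  shows "(\<lambda>n. real (gsat_F n k)) \<in> \<Omega>(\<lambda>n. real n powr (real_of_int \<lfloor>real k / 3\<rfloor> - 5))"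
    and "(\<lambda>n. real (gsat_S n k)) \<in> \<Omega>(\<lambda>n. real n powr (real_of_int \<lfloor>real k / 3\<rfloor> - 5))"
proof -
  have floor: "real_of_int \<lfloor>real k / 3\<rfloor> = real (k div 3)"
    using floor_divide_of_nat_eq[of k 3, where ?'a = real] by simp
  have omega: "(\<lambda>n. real (f n)) \<in> \<Omega>(\<lambda>n. real n powr (real_of_int \<lfloor>real k / 3\<rfloor> - 5))"
    if f: "\<And>n. k \<le> n \<Longrightarrow> 1 \<le> f n"
      "\<And>n. 18 \<le> k \<Longrightarrow> k * (2 * k + 10) \<le> n \<Longrightarrow> (n div k) ^ (k div 3 - 5) \<le> f n" for f
  proof (cases "18 \<le> k")
    case False
    \<comment> \<open>The exponent is then at most 0, so a score of at least 1 suffices.\<close>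
    then have "k div 3 \<le> 5" by simp
    show ?thesis
    proof (rule landau_omega.bigI[where c = 1])
      show "\<forall>\<^sub>F n in sequentially.
        norm (real (f n)) \<ge> 1 * norm (real n powr (real_of_int \<lfloor>real k / 3\<rfloor> - 5))"
        using eventually_ge_at_top[of k]
      proof eventually_elim
        case (elim n)
        have "real n powr (real_of_int \<lfloor>real k / 3\<rfloor> - 5) \<le> real n powr 0"
          using elim assms \<open>k div 3 \<le> 5\<close> unfolding floor by (intro powr_mono) auto
        also have "\<dots> \<le> real (f n)" using f(1)[OF elim] elim assms by simp
        finally show ?case by simp
      qed
    qed simp
  next
    case True
    define e where "e = k div 3 - 5"
    have e: "real_of_int \<lfloor>real k / 3\<rfloor> - 5 = real e"
      unfolding floor e_def using True by (subst of_nat_diff) auto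
    show ?thesis
    \<comment> \<open>The factor 2 absorbs the rounding in \<open>n div k\<close>, which is at least
      \<open>n / k - 1\<close> and hence at least half of \<open>n / k\<close> once
      \<open>2 * k \<le> n\<close>.\<close>
    proof (rule landau_omega.bigI[where c = "(1 / (2 * real k)) ^ e"])
      show "\<forall>\<^sub>F n in sequentially. norm (real (f n)) \<ge>
        (1 / (2 * real k)) ^ e * norm (real n powr (real_of_int \<lfloor>real k / 3\<rfloor> - 5))"
        using eventually_ge_at_top[of "k * (2 * k + 10)"] eventually_ge_at_top[of "2 * k"]
      proof eventually_elim
        case (elim n)
        have "0 < n" using elim(2) assms by simp
        have "real n / real k - 1 \<le> real (n div k)"
          using floor_divide_of_nat_eq[of n k, where ?'a = real] by linarith
        moreover have "2 \<le> real n / real k" using elim(2) assms by (simp add: field_simps)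
        ultimately have *: "real n / (2 * real k) \<le> real (n div k)" by simp
        have "(1 / (2 * real k)) ^ e * real n powr (real_of_int \<lfloor>real k / 3\<rfloor> - 5) =
            (real n / (2 * real k)) ^ e"
          unfolding e using \<open>0 < n\<close> by (simp add: powr_realpow power_divide)
        also have "\<dots> \<le> real (n div k) ^ e" using * by (intro power_mono) auto
        also have "\<dots> \<le> real (f n)"
          using f(2)[OF True elim(1)] unfolding e_def by (metis of_nat_le_iff of_nat_power)
        finally show ?case by simp
      qed
    qed (use assms in simp)
  qed
  have pos: "1 \<le> gsat_F n k" "1 \<le> gsat_S n k" if "k \<le> n" for n
    using game_score_pos that assms by (auto simp: gsat_F_def gsat_S_def)
  have large: "(n div k) ^ (k div 3 - 5) \<le> gsat_F n k" "(n div k) ^ (k div 3 - 5) \<le> gsat_S n k"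
    if "18 \<le> k" "k * (2 * k + 10) \<le> n" for n
  proof -
    have "k * 1 \<le> k * (2 * k + 10)" by (intro mult_left_mono) auto
    then have "k \<le> n" using that(2) unfolding mult_1_right by (rule le_trans)
    show "(n div k) ^ (k div 3 - 5) \<le> gsat_F n k" "(n div k) ^ (k div 3 - 5) \<le> gsat_S n k"
      using that \<open>k \<le> n\<close> by (intro gsat_ge card_ksubsets_supset_ge; simp)+
  qed
  show "(\<lambda>n. real (gsat_F n k)) \<in> \<Omega>(\<lambda>n. real n powr (real_of_int \<lfloor>real k / 3\<rfloor> - 5))"
    by (rule omega) (fact pos large)+
  show "(\<lambda>n. real (gsat_S n k)) \<in> \<Omega>(\<lambda>n. real n powr (real_of_int \<lfloor>real k / 3\<rfloor> - 5))"
    by (rule omega) (fact pos large)+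
qed

theorem theorem1p1:
  fixes k :: nat
  assumes "k \<ge> 2"
  shows "(\<lambda>n::nat. real (gsat_F n k)) \<in> \<Omega>(\<lambda>n. real n powr (real_of_int \<lfloor>real k / 3\<rfloor> - 5)) \<and>
         (\<lambda>n::nat. real (gsat_S n k)) \<in> \<Omega>(\<lambda>n. real n powr (real_of_int \<lfloor>real k / 3\<rfloor> - 5)) \<and>
         (\<lambda>n::nat. real (gsat_F n k)) \<in> O(\<lambda>n. real n powr (real k - sqrt (real k) / 2)) \<and>
         (\<lambda>n::nat. real (gsat_S n k)) \<in> O(\<lambda>n. real n powr (real k - sqrt (real k) / 2))"
  using assms gsat_bigo gsat_bigomega by blast

end
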